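(* Let $M$ be a matroid on ground set $E$ and suppose $Q(M)=\bigcup_{i=1}^tQ(M_i)$ is a matroid base polytope decomposition. Then $$F(M)=\sum_{j\ge1}(-1)^{j-1}\sum_{i_1<i_2<\cdots<i_j}F(M_{i_1}\cap M_{i_2}\cap\cdots\cap M_{i_j}),$$ where the inner sum is over those $i_1<\cdots<i_j$ with $M_{i_1}\cap\cdots\cap M_{i_j}\neq\emptyset$.
   Context: For a set system $N=(E,\mathcal{B})$ with $E$ finite and $\mathcal{B}$ a nonempty family of subsets of $E$ (e.g. the bases of a matroid), and $f:E\to\mathbb{P}=\{1,2,\ldots\}$, call $f$ $N$-generic if the minimum of $f(B)=\sum_{e\in B}f(e)$ over $B\in\mathcal{B}$ is attained by a unique $B$, and set $F(N)=F(N,\mathbf{x})=\sum_{f\ N\text{-generic}}\prod_{e\in E}x_{f(e)}$. For a matroid $M$ on $E$ with bases $\mathcal{B}(M)$, $Q(M)=\mathrm{conv}\{\sum_{i\in B}e_i:B\in\mathcal{B}(M)\}\subset\mathbb{R}^E$ is its matroid base polytope. A matroid base polytope decomposition of $Q(M)$ is an expression $Q(M)=\bigcup_{i=1}^tQ(M_i)$ where each $M_i$ is a matroid on $E$ and, for each $i\ne j$, $Q(M_i)\cap Q(M_j)$ is a face of both $Q(M_i)$ and $Q(M_j)$. For matroids $M_1=(E,\mathcal{B}_1)$, $M_2=(E,\mathcal{B}_2)$ of the same rank, $M_1\cap M_2=(E,\mathcal{B}_1\cap\mathcal{B}_2)$, and one writes $M_1\cap M_2=\emptyset$ if $\mathcal{B}_1\cap\mathcal{B}_2=\emptyset$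 (intersections of several are defined likewise). *)

theory Defs
  imports "HOL-Analysis.Analysis" "HOL-Analysis.Finite_Function_Topology" "HOL-Library.Multiset"
begin

locale set_system =
  fixes E :: "'a set" and \<B> :: "'a set set"
  assumes finite_ground: "finite E"
    and nonempty: "\<B> \<noteq> {}"
    and subset_ground: "B \<in> \<B> \<Longrightarrow> B \<subseteq> E"

locale matroid = set_system E \<B> for E :: "'a set" and \<B> :: "'a set set" +
  assumes exchange:
    "\<lbrakk>A \<in> \<B>; B \<in> \<B>; a \<in> A - B\<rbrakk> \<Longrightarrow> \<exists>b \<in> B - A. insert b (A - {a}) \<in> \<B>"

text \<open>A function on the finite set \<open>E\<close> is represented by its extensional
  version, so that distinct functions on \<open>E\<close> are distinct as HOL functions.\<close>

definition generic :: "'a set \<Rightarrow> 'a set set \<Rightarrow> ('a \<Rightarrow> nat) \<Rightarrow> bool" where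
  "generic E \<B> f \<longleftrightarrow> f \<in> E \<rightarrow>\<^sub>E {1..} \<and> (\<exists>!B. is_arg_min (\<lambda>B. \<Sum>e\<in>B. f e) (\<lambda>B. B \<in> \<B>) B)"

text \<open>A formal power series in the variables \<open>x\<^sub>1, x\<^sub>2, \<dots>\<close> is given by its
  coefficient function. A monomial is the multiset of the indices of its variables, so
  \<open>\<Prod>e\<in>E. x\<^bsub>f e\<^esub>\<close> is \<open>image_mset f (mset_set E)\<close>, and the coefficient of \<open>m\<close> in a sum of
  such monomials is the number of summands equal to \<open>m\<close>.\<close>

type_synonym power_series = "nat multiset \<Rightarrow> int"

definition F :: "'a set \<Rightarrow> 'a set set \<Rightarrow> power_series" where
  "F E \<B> = (\<lambda>m. int (card {f. generic E \<B> f \<and> image_mset f (mset_set E) = m}))"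

lemma finite_generic_monomial:
  assumes "finite E"
  shows "finite {f. generic E \<B> f \<and> image_mset f (mset_set E) = m}"
proof (rule finite_subset)
  show "{f. generic E \<B> f \<and> image_mset f (mset_set E) = m} \<subseteq> E \<rightarrow>\<^sub>E set_mset m"
    using assms by (auto simp: generic_def PiE_def)
  show "finite (E \<rightarrow>\<^sub>E set_mset m)"
    using assms by (intro finite_PiE) auto
qed

text \<open>The space \<open>\<real>\<^sup>E\<close> is the subspace of vectors supported in \<open>E\<close> of the real vector
  space of finitely supported functions; \<open>Poly_Mapping.single i 1\<close> is the basis vector \<open>e\<^sub>i\<close>.\<close>

definition base_polytope :: "'a set set \<Rightarrow> ('a \<Rightarrow>\<^sub>0 real) set" where
  "base_polytope \<B> = convex hull ((\<lambda>B. \<Sum>i\<in>B. Poly_Mapping.single i 1) ` \<B>)"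

definition base_polytope_decomposition ::
    "'a set \<Rightarrow> 'a set set \<Rightarrow> nat \<Rightarrow> (nat \<Rightarrow> 'a set set) \<Rightarrow> bool" where
  "base_polytope_decomposition E \<B> t \<B>s \<longleftrightarrow>
     (\<forall>i\<in>{1..t}. matroid E (\<B>s i)) \<and>
     base_polytope \<B> = (\<Union>i\<in>{1..t}. base_polytope (\<B>s i)) \<and>
     (\<forall>i\<in>{1..t}. \<forall>j\<in>{1..t}. i \<noteq> j \<longrightarrow>
        base_polytope (\<B>s i) \<inter> base_polytope (\<B>s j) face_of base_polytope (\<B>s i) \<and>
        base_polytope (\<B>s i) \<inter> base_polytope (\<B>s j) face_of base_polytope (\<B>s j))"

end

theory Submission
  imports Defs
begin

text \<open>
  Fix \<open>f\<close> and a base \<open>B\<close> with vertex \<open>v\<close>, and let \<open>g\<close> be a linear functional that is larger by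
  at least 1 at every other 0/1-vector than at \<open>v\<close>. For a subfamily of the bases that contains
  \<open>B\<close>, the base \<open>B\<close> fails to be the unique \<open>f\<close>-minimiser iff the polytope of the subfamily meets
  \<open>{x. g x = g v + 1/2 \<and> f x \<le> f v}\<close>; this slice avoids the polytopes not containing \<open>v\<close>. The
  slices of the cells and of their intersections are compact and convex, so the formula reduces to
  the fact that the Euler characteristic (1 on every nonempty compact convex set) respects linear
  relations between indicator functions. The latter follows by slicing along one coordinate at a
  time, which reduces it to compact intervals.
\<close>

section \<open>The Euler characteristic of compact convex sets\<close>

text \<open>Expand a product of factors \<open>1 - 1\<close> over \<open>S\<close>; it vanishes
  because \<open>S\<close> has an element. It serves as inclusion-exclusion twice: at a point of the
  polytope and at a fixed base.\<close>

lemma sum_neg_one_power_card_Pow: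
  assumes "finite S" "S \<noteq> {}"
  shows "(\<Sum>I\<in>Pow S. (-1) ^ card I) = (0::int)"
proof -
  have "(\<Prod>x\<in>S. (1::int) - 1) = (\<Sum>I\<in>Pow S. (-1) ^ card I * (\<Prod>x\<in>I. 1) * (\<Prod>x\<in>S-I. 1))"
    by (rule prod_diff_conv_sum) (fact assms)
  then show ?thesis
    using assms by (simp add: card_gt_0_iff zero_power)
qed

text \<open>The jump from \<open>s\<close> to \<open>s+\<close> counts exactly the intervals whose right endpoint is \<open>s\<close>.\<close>

lemma sum_compact_intervals_eq_0:
  fixes J :: "'i \<Rightarrow> real set" and a :: "'i \<Rightarrow> int"
  assumes fin: "finite A"
    and J: "\<And>i. i \<in> A \<Longrightarrow> compact (J i)" "\<And>i. i \<in> A \<Longrightarrow> convex (J i)"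
    and zero: "\<And>s. sum a {i \<in> A. s \<in> J i} = 0"
  shows "sum a {i \<in> A. J i \<noteq> {}} = 0"
proof -
  define N where "N = {i \<in> A. J i \<noteq> {}}"
  have finN: "finite N"
    using fin by (simp add: N_def)
  have "\<exists>l r. l \<le> r \<and> J i = {l..r}" if "i \<in> N" for i
  proof -
    have "compact (J i)" "connected (J i)" "J i \<noteq> {}"
      using that J by (auto simp: N_def convex_connected)
    then show ?thesis
      using connected_compact_interval_1[of "J i"] by (metis atLeastatMost_empty_iff)
  qed
  then obtain l r where lr: "\<And>i. i \<in> N \<Longrightarrow> l i \<le> r i" "\<And>i. i \<in> N \<Longrightarrow> J i = {l i..r i}"
    by metis
  have jump: "sum a {i \<in> N. r i = s} = 0" for s
  proof -
    have "\<forall>\<^sub>F u in at_right s. u \<in> J i \<longleftrightarrow> s \<in> J i \<and> r i \<noteq> s" if i: "i \<in> N" for i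
    proof -
      consider "s < l i" | "s \<ge> r i" | "l i \<le> s" "s < r i"
        by linarith
      then show ?thesis
      proof cases
        case 1
        then have "\<forall>\<^sub>F u in at_right s. u \<in> {s<..<l i}"
          by (rule eventually_at_right_real)
        then show ?thesis
          by eventually_elim (use 1 lr[OF i] in auto)
      next
        case 2
        show ?thesis
          using eventually_at_right_less[of s]
          by eventually_elim (use 2 lr[OF i] in auto)
      next
        case 3
        then have "\<forall>\<^sub>F u in at_right s. u \<in> {s<..<r i}"
          by (intro eventually_at_right_real)
        then show ?thesis
          by eventually_elim (use 3 lr[OF i] in auto)
      qed
    qed
    \<comment> \<open>As \<open>N\<close> is finite, one point \<open>u\<close> beyond
      \<open>s\<close> serves all intervals at once.\<close>
    then have "\<forall>\<^sub>F u in at_right s. \<forall>i\<in>N. u \<in> J i \<longleftrightarrow> s \<in> J i \<and> r i \<noteq> s"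
      using finN by (intro eventually_ball_finite) auto
    then obtain u where u: "\<forall>i\<in>N. u \<in> J i \<longleftrightarrow> s \<in> J i \<and> r i \<noteq> s"
      using eventually_happens'[OF trivial_limit_at_right_real] by blast
    have "{i \<in> A. s \<in> J i} = {i \<in> N. r i = s} \<union> {i \<in> A. u \<in> J i}"
    proof (intro set_eqI iffI)
      fix i assume "i \<in> {i \<in> A. s \<in> J i}"
      then show "i \<in> {i \<in> N. r i = s} \<union> {i \<in> A. u \<in> J i}"
        using u by (auto simp: N_def)
    next
      fix i assume i: "i \<in> {i \<in> N. r i = s} \<union> {i \<in> A. u \<in> J i}"
      then have "i \<in> N"
        by (auto simp: N_def)
      moreover from this have "s \<in> J i"
        using i u lr[of i] by auto
      ultimately show "i \<in> {i \<in> A. s \<in> J i}"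
        by (simp add: N_def)
    qed
    moreover have "{i \<in> N. r i = s} \<inter> {i \<in> A. u \<in> J i} = {}"
      using u by (auto simp: N_def)
    ultimately have "sum a {i \<in> A. s \<in> J i} = sum a {i \<in> N. r i = s} + sum a {i \<in> A. u \<in> J i}"
      using fin finN by (simp add: sum.union_disjoint)
    then show ?thesis
      using zero by simp
  qed
  \<comment> \<open>Every nonempty interval has exactly one right endpoint, so grouping by endpoints
    splits the sum into vanishing jumps.\<close>
  have "sum a N = (\<Sum>s\<in>r ` N. sum a {i \<in> N. r i = s})"
    using finN by (rule sum.image_gen)
  then show ?thesis
    using jump by (simp add: N_def)
qed

text \<open>Induction on \<open>L\<close>, which acts as a coordinate system: on a level set of one
  functional the remaining ones still separate points, and the images under that functional are
  compact intervals. Separation is demanded only between points of the sets \<open>K i\<close>, so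
  the ambient space may have infinite dimension.\<close>

lemma sum_compact_convex_eq_0:
  fixes K :: "'i \<Rightarrow> 'v::real_normed_vector set" and a :: "'i \<Rightarrow> int" and L :: "('v \<Rightarrow> real) set"
  assumes fin: "finite A" and "finite L"
    and "\<And>l. l \<in> L \<Longrightarrow> bounded_linear l"
    and "\<And>i j x y. \<lbrakk>i \<in> A; j \<in> A; x \<in> K i; y \<in> K j; \<forall>l\<in>L. l x = l y\<rbrakk> \<Longrightarrow> x = y"
    and "\<And>i. i \<in> A \<Longrightarrow> compact (K i)" "\<And>i. i \<in> A \<Longrightarrow> convex (K i)"
    and "\<And>x. sum a {i \<in> A. x \<in> K i} = 0"
  shows "sum a {i \<in> A. K i \<noteq> {}} = 0"
  using assms(2-)
proof (induction L arbitrary: K rule: finite_induct)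
  \<comment> \<open>With no functionals left, separation forces all points of all \<open>K i\<close>
    to coincide, so nonempty means containing that one point.\<close>
  case empty
  show ?case
  proof (cases "\<exists>i\<in>A. K i \<noteq> {}")
    case True
    then obtain i x where "i \<in> A" "x \<in> K i"
      by blast
    then have "{i \<in> A. K i \<noteq> {}} = {i \<in> A. x \<in> K i}"
      using empty.prems(2) by blast
    then show ?thesis
      using empty.prems(5) by simp
  next
    case False
    then have "{i \<in> A. K i \<noteq> {}} = {}"
      by blast
    then show ?thesis
      by (metis sum.empty)
  qed
next
  case (insert l L)
  interpret l: bounded_linear l
    using insert.prems(1) by simp
  have slice: "sum a {i \<in> A. s \<in> l ` K i} = 0" for s
  proof -
    have closed: "closed {x. l x = s}"
      by (intro closed_Collect_eq l.continuous_on continuous_on_id continuous_on_const)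
    have "convex (l -` {s})"
      by (intro convex_linear_vimage l.linear_axioms) simp
    then have conv: "convex {x. l x = s}"
      by (simp add: vimage_def)
    have "sum a {i \<in> A. K i \<inter> {x. l x = s} \<noteq> {}} = 0"
    proof (rule insert.IH)
      fix i j x y
      assume "i \<in> A" "j \<in> A" "x \<in> K i \<inter> {x. l x = s}" "y \<in> K j \<inter> {x. l x = s}"
        "\<forall>l\<in>L. l x = l y"
      then show "x = y"
        by (intro insert.prems(2)[of i j x y]) auto
    next
      fix x
      show "sum a {i \<in> A. x \<in> K i \<inter> {x. l x = s}} = 0"
        using insert.prems(5)[of x] by (cases "l x = s") simp_all
    qed (use insert.prems(1,3,4) closed conv in \<open>auto intro: compact_Int_closed convex_Int\<close>)
    moreover have "{i \<in> A. K i \<inter> {x. l x = s} \<noteq> {}} = {i \<in> A. s \<in> l ` K i}"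
      by auto
    ultimately show ?thesis
      by simp
  qed
  have "sum a {i \<in> A. l ` K i \<noteq> {}} = 0"
    using insert.prems(3,4) slice
    by (intro sum_compact_intervals_eq_0[OF fin])
      (auto intro!: compact_continuous_image convex_linear_image l.continuous_on l.linear_axioms
        continuous_on_id)
  then show ?case
    by simp
qed

section \<open>Polytopes spanned by 0/1-vectors\<close>

text \<open>Peel generators off \<open>R\<close> one by one: a face that meets an open segment of
  the hull contains both endpoints. \<open>S\<close> stays fixed while \<open>R\<close> shrinks, so
  that \<open>T\<close> remains a face of the same convex set throughout the induction.\<close>

lemma face_of_Int_convex_hull_finite:
  fixes S :: "'v::real_vector set"
  assumes "T face_of convex hull S" "finite R" "R \<subseteq> S" "x \<in> convex hull R" "x \<in> T"
  shows "x \<in> convex hull (R \<inter> T)"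
  using assms(2-)
proof (induction R arbitrary: x rule: finite_induct)
  case empty
  then show ?case
    by simp
next
  case (insert r R)
  show ?case
  proof (cases "R = {}")
    case True
    then show ?thesis
      using insert.prems by simp
  next
    case False
    obtain u v y where uv: "0 \<le> u" "0 \<le> v" "u + v = 1" and y: "y \<in> convex hull R"
      and x: "x = u *\<^sub>R r + v *\<^sub>R y"
      using insert.prems(2) by (auto simp: convex_hull_insert[OF False])
    have mono: "convex hull (R \<inter> T) \<subseteq> convex hull (insert r R \<inter> T)"
      by (intro hull_mono) auto
    have r_case: ?thesis if "x = r"
      using that insert.prems(3) by (intro hull_inc) simp
    \<comment> \<open>The first two cases collapse \<open>x\<close> to \<open>r\<close> or to
      \<open>y\<close>; in the third it lies in an open segment, where the face property
      applies.\<close>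
    consider "v = 0 \<or> y = r" | "u = 0" | "0 < u" "0 < v" "y \<noteq> r"
      using uv by fastforce
    then show ?thesis
    proof cases
      case 1
      then have "x = r"
        using uv x by (auto simp flip: scaleR_left_distrib)
      then show ?thesis
        by (rule r_case)
    next
      case 2
      then have "x = y"
        using uv x by simp
      then show ?thesis
        using insert.IH[of x] insert.prems y mono by auto
    next
      case 3
      have "x \<in> open_segment r y"
        using 3 uv x by (auto simp: in_segment intro!: exI[of _ v])
      moreover have "r \<in> convex hull S"
        using insert.prems(1) by (intro hull_inc) simp
      moreover have "y \<in> convex hull S"
        using y hull_mono[of R S] insert.prems(1) by auto
      ultimately have "r \<in> T" "y \<in> T"
        using face_ofD[OF assms(1)] insert.prems(3) by blast+
      then have "y \<in> convex hull (insert r R \<inter> T)" "r \<in> convex hull (insert r R \<inter> T)"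
        using insert.IH[of y] insert.prems(1) y mono by (auto intro: hull_inc)
      then show ?thesis
        unfolding x using uv by (intro convexD[OF convex_convex_hull])
    qed
  qed
qed

section \<open>Indicator vectors, linear functionals and slices near a vertex\<close>

definition indicator_vector :: "'a set \<Rightarrow> 'a \<Rightarrow>\<^sub>0 real" where
  "indicator_vector B = (\<Sum>i\<in>B. Poly_Mapping.single i 1)"

lemma base_polytope_eq: "base_polytope \<B> = convex hull (indicator_vector ` \<B>)"
  by (simp add: base_polytope_def indicator_vector_def)

lemma lookup_indicator_vector:
  "finite B \<Longrightarrow> Poly_Mapping.lookup (indicator_vector B) e = of_bool (e \<in> B)"
  by (simp add: indicator_vector_def lookup_sum lookup_single when_def)

lemma bounded_linear_lookup: "bounded_linear (\<lambda>x :: 'a \<Rightarrow>\<^sub>0 real. Poly_Mapping.lookup x e)"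
proof (rule bounded_linear_intro[where K = 1])
  fix x :: "'a \<Rightarrow>\<^sub>0 real" and r :: real
  \<comment> \<open>Finite support allows \<open>Poly_Mapping.lookup\<close> to be evaluated on the
    scalar multiple.\<close>
  have "finite {i. r *\<^sub>R Poly_Mapping.lookup x i \<noteq> 0}"
    by (rule finite_subset[OF _ finite_keys[of x]]) (auto simp: in_keys_iff)
  then show "Poly_Mapping.lookup (r *\<^sub>R x) e = r *\<^sub>R Poly_Mapping.lookup x e"
    by (simp add: scaleR_poly_mapping_def)
  show "norm (Poly_Mapping.lookup x e) \<le> norm x * 1"
  proof (cases "e \<in> Poly_Mapping.keys x")
    case True
    then have "norm (Poly_Mapping.lookup x e) \<le> (\<Sum>i\<in>Poly_Mapping.keys x. norm (Poly_Mapping.lookup x i))"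
      by (intro member_le_sum) auto
    then show ?thesis
      by (simp add: norm_poly_mapping_def dist_poly_mapping_def)
  qed (simp add: in_keys_iff)
qed (simp add: lookup_add)

definition pairing :: "'a set \<Rightarrow> ('a \<Rightarrow> real) \<Rightarrow> ('a \<Rightarrow>\<^sub>0 real) \<Rightarrow> real" where
  "pairing E c x = (\<Sum>e\<in>E. c e * Poly_Mapping.lookup x e)"

lemma bounded_linear_pairing: "bounded_linear (pairing E c)"
  unfolding pairing_def
  by (intro bounded_linear_sum bounded_linear_const_mult bounded_linear_lookup)

lemma pairing_indicator_vector:
  assumes "finite E" "B \<subseteq> E"
  shows "pairing E c (indicator_vector B) = sum c B"
proof -
  have "finite B"
    using assms finite_subset by blast
  have "pairing E c (indicator_vector B) = (\<Sum>e\<in>E. if e \<in> B then c e else 0)"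
    unfolding pairing_def using \<open>finite B\<close>
    by (intro sum.cong) (auto simp: lookup_indicator_vector)
  also have "\<dots> = sum c (E \<inter> B)"
    using assms(1) by (simp add: sum.inter_restrict)
  also have "E \<inter> B = B"
    using assms(2) by blast
  finally show ?thesis .
qed

text \<open>Weight -1 on \<open>B\<close> and 1 off \<open>B\<close>: the excess over the value at
  \<open>B\<close> is the size of the symmetric difference, a positive integer.\<close>

lemma ex_vertex_functional:
  assumes "finite E" "B \<subseteq> E"
  shows "\<exists>g :: ('a \<Rightarrow>\<^sub>0 real) \<Rightarrow> real. bounded_linear g \<and>
    (\<forall>C. C \<subseteq> E \<longrightarrow> C \<noteq> B \<longrightarrow> g (indicator_vector B) + 1 \<le> g (indicator_vector C))"
proof (intro exI conjI allI impI)
  let ?c = "\<lambda>e. if e \<in> B then -1 else 1 :: real"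
  show "bounded_linear (pairing E ?c)"
    by (rule bounded_linear_pairing)
  fix C assume C: "C \<subseteq> E" "C \<noteq> B"
  have fin: "finite B" "finite C"
    using assms C finite_subset by blast+
  have "sum ?c C - sum ?c B = real (card (C - B)) + real (card (B - C))"
  proof -
    have "sum ?c C = sum ?c (C \<inter> B) + sum ?c (C - B)" "sum ?c B = sum ?c (B \<inter> C) + sum ?c (B - C)"
      by (rule sum.Int_Diff[OF fin(2)], rule sum.Int_Diff[OF fin(1)])
    moreover have "sum ?c (C - B) = real (card (C - B))" "sum ?c (B - C) = - real (card (B - C))"
      by simp_all
    ultimately show ?thesis
      by (simp add: Int_commute)
  qed
  moreover have "card (C - B) + card (B - C) \<noteq> 0"
    using C fin by auto
  then have "real (card (C - B)) + real (card (B - C)) \<ge> 1"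
    by linarith
  ultimately show "pairing E ?c (indicator_vector B) + 1 \<le> pairing E ?c (indicator_vector C)"
    using assms C by (simp add: pairing_indicator_vector)
qed

lemma base_polytope_functional_ge:
  fixes g :: "('a \<Rightarrow>\<^sub>0 real) \<Rightarrow> real"
  assumes "bounded_linear g" "\<And>C. C \<in> \<C> \<Longrightarrow> b \<le> g (indicator_vector C)" "x \<in> base_polytope \<C>"
  shows "b \<le> g x"
proof -
  interpret g: bounded_linear g by fact
  have "convex (g -` {b..})"
    by (intro convex_linear_vimage g.linear_axioms) simp
  then have "base_polytope \<C> \<subseteq> g -` {b..}"
    unfolding base_polytope_eq using assms(2) by (intro hull_minimal) auto
  then show ?thesis
    using assms(3) by auto
qed

text \<open>A vertex of the cube is no convex combination of other vertices, since the functional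
  above keeps those at distance. Hence a family can be read off from its polytope.\<close>

lemma indicator_vector_in_base_polytope:
  fixes E :: "'a set"
  assumes "finite E" "\<C> \<subseteq> Pow E" "B \<subseteq> E"
  shows "indicator_vector B \<in> base_polytope \<C> \<longleftrightarrow> B \<in> \<C>"
proof
  assume v: "indicator_vector B \<in> base_polytope \<C>"
  obtain g :: "('a \<Rightarrow>\<^sub>0 real) \<Rightarrow> real" where g: "bounded_linear g"
    "\<And>C. \<lbrakk>C \<subseteq> E; C \<noteq> B\<rbrakk> \<Longrightarrow> g (indicator_vector B) + 1 \<le> g (indicator_vector C)"
    using ex_vertex_functional[OF assms(1,3)] by blast
  show "B \<in> \<C>"
  proof (rule ccontr)
    assume "B \<notin> \<C>"
    then have "g (indicator_vector B) + 1 \<le> g (indicator_vector B)"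
      using assms(2) by (intro base_polytope_functional_ge[OF g(1) _ v] g(2)) auto
    then show False
      by simp
  qed
qed (simp add: base_polytope_eq hull_inc)

lemma base_polytope_mono: "\<C> \<subseteq> \<D> \<Longrightarrow> base_polytope \<C> \<subseteq> base_polytope \<D>"
  unfolding base_polytope_eq by (intro hull_mono image_mono)

text \<open>Polymorphic in the values: weights are real when they define a functional on polytopes
  and natural in \<open>generic\<close>.\<close>

definition unique_minimizer :: "('a \<Rightarrow> 'b::{comm_monoid_add, linorder}) \<Rightarrow> 'a set set \<Rightarrow> 'a set \<Rightarrow> bool" where
  "unique_minimizer f \<C> B \<longleftrightarrow> B \<in> \<C> \<and> (\<forall>C\<in>\<C> - {B}. sum f B < sum f C)"

text \<open>The level of \<open>g\<close> halfway to the gap separates the vertex of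
  \<open>B\<close> from all other 0/1-vectors. A point of the slice thus lies strictly between that
  vertex and a point of the hull of the others, and whether \<open>f\<close> rises along this
  segment is decided by its far end.\<close>

lemma vertex_slice_nonempty_iff:
  fixes f :: "'a \<Rightarrow> real" and g :: "('a \<Rightarrow>\<^sub>0 real) \<Rightarrow> real"
  assumes E: "finite E" "\<C> \<subseteq> Pow E" "B \<subseteq> E"
    and g: "bounded_linear g"
      "\<And>C. \<lbrakk>C \<subseteq> E; C \<noteq> B\<rbrakk> \<Longrightarrow> g (indicator_vector B) + 1 \<le> g (indicator_vector C)"
  shows "base_polytope \<C> \<inter> {x. g x = g (indicator_vector B) + 1/2 \<and> pairing E f x \<le> sum f B} \<noteq> {}
    \<longleftrightarrow> B \<in> \<C> \<and> \<not> unique_minimizer f \<C> B" (is "?K \<noteq> {} \<longleftrightarrow> _")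
proof -
  let ?v = "indicator_vector B"
  interpret g: bounded_linear g by fact
  interpret p: bounded_linear "pairing E f" by (rule bounded_linear_pairing)
  have pv: "pairing E f (indicator_vector C) = sum f C" if "C \<subseteq> E" for C
    using pairing_indicator_vector E(1) that by blast
  show ?thesis
  proof (intro iffI conjI)
    assume "?K \<noteq> {}"
    then obtain x where x: "x \<in> base_polytope \<C>" "g x = g ?v + 1/2" "pairing E f x \<le> sum f B"
      by blast
    show B: "B \<in> \<C>"
    proof (rule ccontr)
      assume "B \<notin> \<C>"
      then have "g ?v + 1 \<le> g x"
        using E by (intro base_polytope_functional_ge[OF g(1) _ x(1)] g(2)) auto
      then show False
        using x(2) by simp
    qed
    show "\<not> unique_minimizer f \<C> B"
    proof
      assume min: "unique_minimizer f \<C> B"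
      define \<D> where "\<D> = \<C> - {B}"
      have "\<C> = insert B \<D>"
        using B by (auto simp: \<D>_def)
      then have hull: "x \<in> convex hull (insert ?v (indicator_vector ` \<D>))"
        using x(1) by (simp add: base_polytope_eq)
      have "x \<noteq> ?v"
        using x(2) by auto
      then have "\<D> \<noteq> {}"
        using hull by auto
      \<comment> \<open>Split off the vertex of \<open>B\<close>; \<open>y\<close> lies in the hull
        of the competitors, where \<open>f\<close> is strictly larger.\<close>
      then obtain u w y where uw: "0 \<le> u" "0 \<le> w" "u + w = 1"
        and y: "y \<in> convex hull (indicator_vector ` \<D>)" and xeq: "x = u *\<^sub>R ?v + w *\<^sub>R y"
        using hull by (auto simp: convex_hull_insert)
      have "convex (pairing E f -` {sum f B<..})"
        by (intro convex_linear_vimage p.linear_axioms) simp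
      moreover have "sum f B < pairing E f (indicator_vector C)" if "C \<in> \<D>" for C
      proof -
        have "C \<subseteq> E" "sum f B < sum f C"
          using that min E(2) unfolding \<D>_def unique_minimizer_def by blast+
        then show ?thesis
          by (simp add: pv)
      qed
      ultimately have "convex hull (indicator_vector ` \<D>) \<subseteq> pairing E f -` {sum f B<..}"
        by (intro hull_minimal) auto
      then have py: "pairing E f y > sum f B"
        using y by auto
      have "w \<noteq> 0"
        using \<open>x \<noteq> ?v\<close> xeq uw by auto
      then have "w * (pairing E f y - sum f B) > 0"
        using py uw by simp
      moreover have "u = 1 - w"
        using uw by simp
      then have "pairing E f x = sum f B + w * (pairing E f y - sum f B)"
        using E(3) by (simp only: xeq p.add p.scaleR pv) (simp add: algebra_simps)
      ultimately show False
        using x(3) by simp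
    qed
  next
    assume asm: "B \<in> \<C> \<and> \<not> unique_minimizer f \<C> B"
    then obtain C where C: "C \<in> \<C>" "C \<noteq> B" "sum f C \<le> sum f B"
      by (force simp: unique_minimizer_def)
    \<comment> \<open>This weight raises \<open>g\<close> by exactly 1/2 on the segment from
      \<open>B\<close> to \<open>C\<close>; the gap of at least 1 keeps it within [0, 1].\<close>
    define w where "w = 1 / (2 * (g (indicator_vector C) - g ?v))"
    define x where "x = (1 - w) *\<^sub>R ?v + w *\<^sub>R indicator_vector C"
    have gap: "g (indicator_vector C) - g ?v \<ge> 1"
      using g(2)[of C] C E(2) by force
    then have w: "0 \<le> w" "w \<le> 1"
      by (auto simp: w_def field_simps)
    have "x \<in> base_polytope \<C>"
      unfolding base_polytope_eq x_def using w asm C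
      by (intro convexD[OF convex_convex_hull] hull_inc) auto
    moreover have "g x = g ?v + w * (g (indicator_vector C) - g ?v)"
      by (simp only: x_def g.add g.scaleR) (simp add: algebra_simps)
    then have "g x = g ?v + 1/2"
      using gap by (simp add: w_def)
    moreover have "pairing E f x = sum f B + w * (sum f C - sum f B)"
      using C(1) E pv[of B] pv[of C] by (auto simp only: x_def p.add p.scaleR) (auto simp: algebra_simps)
    moreover have "w * (sum f C - sum f B) \<le> 0"
      using w(1) C(3) by (intro mult_nonneg_nonpos) auto
    ultimately show "?K \<noteq> {}"
      by auto
  qed
qed

section \<open>Decompositions\<close>

lemma matroid_subset_Pow: "matroid E \<B> \<Longrightarrow> \<B> \<subseteq> Pow E"
  using set_system.subset_ground by (fastforce simp: matroid_def)

lemma matroid_finite_ground: "matroid E \<B> \<Longrightarrow> finite E"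
  by (simp add: matroid_def set_system_def)

lemma matroid_indicator_vector_in_base_polytope:
  assumes "matroid E \<C>" "B \<subseteq> E"
  shows "indicator_vector B \<in> base_polytope \<C> \<longleftrightarrow> B \<in> \<C>"
  using indicator_vector_in_base_polytope matroid_finite_ground matroid_subset_Pow assms by metis

lemma decomposition_subset:
  assumes "matroid E \<B>" "base_polytope_decomposition E \<B> t \<B>s" "i \<in> {1..t}"
  shows "\<B>s i \<subseteq> \<B>"
proof
  fix B assume B: "B \<in> \<B>s i"
  have "matroid E (\<B>s i)"
    using assms by (simp add: base_polytope_decomposition_def)
  then have BE: "B \<subseteq> E"
    using matroid_subset_Pow B by blast
  have "indicator_vector B \<in> base_polytope (\<B>s i)"
    using B by (simp add: base_polytope_eq hull_inc)
  then have "indicator_vector B \<in> base_polytope \<B>"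
    using assms(2,3) by (auto simp: base_polytope_decomposition_def)
  then show "B \<in> \<B>"
    using matroid_indicator_vector_in_base_polytope[OF assms(1) BE] by simp
qed

lemma decomposition_covers:
  assumes "matroid E \<B>" "base_polytope_decomposition E \<B> t \<B>s" "B \<in> \<B>"
  obtains i where "i \<in> {1..t}" "B \<in> \<B>s i"
proof -
  have "indicator_vector B \<in> base_polytope \<B>"
    using assms(3) by (simp add: base_polytope_eq hull_inc)
  then obtain i where i: "i \<in> {1..t}" "indicator_vector B \<in> base_polytope (\<B>s i)"
    using assms(2) by (auto simp: base_polytope_decomposition_def)
  moreover have "matroid E (\<B>s i)"
    using assms(2) i by (simp add: base_polytope_decomposition_def)
  moreover have "B \<subseteq> E"
    using assms(1,3) matroid_subset_Pow by blast
  ultimately show ?thesis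
    using that matroid_indicator_vector_in_base_polytope by metis
qed

text \<open>Intersecting with \<open>\<B>\<close> only matters for \<open>I = {}\<close>: it makes the empty intersection \<open>\<B>\<close>, so
  that both sides of the theorem become one alternating sum over all \<open>I\<close>.\<close>

definition cell :: "'a set set \<Rightarrow> (nat \<Rightarrow> 'a set set) \<Rightarrow> nat set \<Rightarrow> 'a set set" where
  "cell \<B> \<B>s I = \<B> \<inter> (\<Inter>i\<in>I. \<B>s i)"

text \<open>This is where the face condition enters. The intersection is a face of any one cell
  polytope involved, hence the hull of the vertices it contains, and these come from the common
  bases.\<close>

lemma base_polytope_cell:
  assumes M: "matroid E \<B>" and D: "base_polytope_decomposition E \<B> t \<B>s" and I: "I \<subseteq> {1..t}"
  shows "base_polytope (cell \<B> \<B>s I) = base_polytope \<B> \<inter> (\<Inter>i\<in>I. base_polytope (\<B>s i))"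
proof (intro equalityI)
  have "base_polytope (cell \<B> \<B>s I) \<subseteq> base_polytope (\<B>s i)" if "i \<in> I" for i
    using that by (intro base_polytope_mono) (auto simp: cell_def)
  moreover have "base_polytope (cell \<B> \<B>s I) \<subseteq> base_polytope \<B>"
    by (intro base_polytope_mono) (auto simp: cell_def)
  ultimately show "base_polytope (cell \<B> \<B>s I)
      \<subseteq> base_polytope \<B> \<inter> (\<Inter>i\<in>I. base_polytope (\<B>s i))"
    by auto
next
  show "base_polytope \<B> \<inter> (\<Inter>i\<in>I. base_polytope (\<B>s i)) \<subseteq> base_polytope (cell \<B> \<B>s I)"
  proof (cases "I = {}")
    case True
    then show ?thesis
      by (simp add: cell_def)
  next
    case False
    then obtain k where k: "k \<in> I"
      by blast
    then have kt: "k \<in> {1..t}"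
      using I by auto
    have mat: "matroid E (\<B>s i)" if "i \<in> I" for i
      using that D I by (auto simp: base_polytope_decomposition_def)
    define T where "T = (\<Inter>i\<in>I. base_polytope (\<B>s i))"
    \<comment> \<open>Intersecting every member with the \<open>k\<close>-th polytope exhibits
      \<open>T\<close> as an intersection of faces of that polytope; the term for
      \<open>i = k\<close> is the whole polytope.\<close>
    have "T = (\<Inter>i\<in>I. base_polytope (\<B>s k) \<inter> base_polytope (\<B>s i))"
      using k by (auto simp: T_def)
    also have "\<dots> face_of base_polytope (\<B>s k)"
    proof (rule face_of_Inter)
      fix S assume "S \<in> (\<lambda>i. base_polytope (\<B>s k) \<inter> base_polytope (\<B>s i)) ` I"
      then obtain i where i: "i \<in> I" and S: "S = base_polytope (\<B>s k) \<inter> base_polytope (\<B>s i)"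
        by blast
      show "S face_of base_polytope (\<B>s k)"
      proof (cases "i = k")
        case True
        then show ?thesis
          unfolding S by (simp add: face_of_refl base_polytope_eq)
      next
        case False
        then show ?thesis
          unfolding S using D I i kt by (auto simp: base_polytope_decomposition_def)
      qed
    qed (use False in simp)
    finally have face: "T face_of convex hull (indicator_vector ` \<B>s k)"
      by (simp add: base_polytope_eq)
    have fin: "finite (\<B>s k)"
      using mat[OF k] matroid_subset_Pow matroid_finite_ground by (metis finite_Pow_iff finite_subset)
    have "indicator_vector ` \<B>s k \<inter> T \<subseteq> indicator_vector ` cell \<B> \<B>s I"
    proof
      fix x assume "x \<in> indicator_vector ` \<B>s k \<inter> T"
      then obtain B where B: "B \<in> \<B>s k" "x = indicator_vector B"
        and BT: "\<And>i. i \<in> I \<Longrightarrow> indicator_vector B \<in> base_polytope (\<B>s i)"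
        by (auto simp: T_def)
      have "B \<subseteq> E"
        using B(1) mat[OF k] matroid_subset_Pow by blast
      then have "B \<in> \<B>s i" if "i \<in> I" for i
        using BT[OF that] matroid_indicator_vector_in_base_polytope[OF mat[OF that]] by simp
      moreover have "B \<in> \<B>"
        using decomposition_subset[OF M D kt] B(1) by blast
      ultimately show "x \<in> indicator_vector ` cell \<B> \<B>s I"
        using B(2) by (auto simp: cell_def)
    qed
    then have "convex hull (indicator_vector ` \<B>s k \<inter> T) \<subseteq> base_polytope (cell \<B> \<B>s I)"
      unfolding base_polytope_eq by (rule hull_mono)
    moreover have "T \<subseteq> convex hull (indicator_vector ` \<B>s k \<inter> T)"
    proof
      fix x assume "x \<in> T"
      then show "x \<in> convex hull (indicator_vector ` \<B>s k \<inter> T)"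
        using face_of_imp_subset[OF face] fin
        by (intro face_of_Int_convex_hull_finite[OF face]) auto
    qed
    ultimately show ?thesis
      by (auto simp: T_def)
  qed
qed

text \<open>The vector type also has coordinates outside \<open>E\<close>; their vanishing makes the
  finitely many coordinates in \<open>E\<close> separate points of the polytopes.\<close>

lemma base_polytope_lookup_outside:
  assumes "finite E" "\<C> \<subseteq> Pow E" "x \<in> base_polytope \<C>" "e \<notin> E"
  shows "Poly_Mapping.lookup x e = 0"
proof -
  have zero: "Poly_Mapping.lookup (indicator_vector C) e = 0" if "C \<in> \<C>" for C
  proof -
    have "finite C" "e \<notin> C"
      using that assms finite_subset by blast+
    then show ?thesis
      by (simp add: lookup_indicator_vector)
  qed
  have "0 \<le> Poly_Mapping.lookup x e"
    using zero by (intro base_polytope_functional_ge[OF bounded_linear_lookup _ assms(3)]) simp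
  moreover have "0 \<le> - Poly_Mapping.lookup x e"
    using zero
    by (intro base_polytope_functional_ge[OF bounded_linear_minus[OF bounded_linear_lookup] _ assms(3)]) simp
  ultimately show ?thesis
    by simp
qed

text \<open>Among the \<open>I\<close> whose cell contains \<open>B\<close>, the signs cancel in
  total. They also cancel over those where \<open>B\<close> is not the unique minimiser, since these
  are the \<open>I\<close> with nonempty slice. The difference is the claim.\<close>

lemma sum_unique_minimizer_eq_0:
  fixes f :: "'a \<Rightarrow> real"
  assumes M: "matroid E \<B>" and D: "base_polytope_decomposition E \<B> t \<B>s" and B: "B \<in> \<B>"
  shows "(\<Sum>I | I \<in> Pow {1..t} \<and> unique_minimizer f (cell \<B> \<B>s I) B. (-1) ^ card I) = (0::int)"
proof -
  have E: "finite E" "\<B> \<subseteq> Pow E" "B \<subseteq> E"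
    using M B matroid_subset_Pow matroid_finite_ground by blast+
  have cellE: "cell \<B> \<B>s I \<subseteq> Pow E" for I
    using E(2) by (auto simp: cell_def)
  obtain g :: "('a \<Rightarrow>\<^sub>0 real) \<Rightarrow> real" where g: "bounded_linear g"
      "\<And>C. \<lbrakk>C \<subseteq> E; C \<noteq> B\<rbrakk> \<Longrightarrow> g (indicator_vector B) + 1 \<le> g (indicator_vector C)"
    using ex_vertex_functional[OF E(1,3)] by blast
  interpret g: bounded_linear g by fact
  interpret p: bounded_linear "pairing E f" by (rule bounded_linear_pairing)
  define H where "H = {x. g x = g (indicator_vector B) + 1/2 \<and> pairing E f x \<le> sum f B}"
  define K where "K I = base_polytope (cell \<B> \<B>s I) \<inter> H" for I
  have H: "H = g -` {g (indicator_vector B) + 1/2} \<inter> pairing E f -` {..sum f B}"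
    by (auto simp: H_def)
  have "convex H"
    unfolding H
    by (intro convex_Int convex_linear_vimage g.linear_axioms p.linear_axioms) auto
  have "closed H"
    unfolding H
    by (intro closed_Int closed_vimage g.continuous_on p.continuous_on continuous_on_id) auto
  have finP: "finite (Pow {1..t})"
    by simp
  have K0: "(\<Sum>I | I \<in> Pow {1..t} \<and> K I \<noteq> {}. (-1) ^ card I) = (0::int)"
  proof (rule sum_compact_convex_eq_0[where L = "(\<lambda>e x. Poly_Mapping.lookup x e) ` E", OF finP])
    show "finite ((\<lambda>e (x :: 'a \<Rightarrow>\<^sub>0 real). Poly_Mapping.lookup x e) ` E)"
      using E(1) by simp
    show "bounded_linear l" if "l \<in> (\<lambda>e (x :: 'a \<Rightarrow>\<^sub>0 real). Poly_Mapping.lookup x e) ` E" for l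
      using that by (auto intro: bounded_linear_lookup)
    show "x = y" if "x \<in> K I" "y \<in> K J"
      "\<forall>l\<in>(\<lambda>e x. Poly_Mapping.lookup x e) ` E. l x = l y" for I J x y
    proof (rule poly_mapping_eqI)
      fix e
      show "Poly_Mapping.lookup x e = Poly_Mapping.lookup y e"
      proof (cases "e \<in> E")
        case True
        then show ?thesis
          using that(3) by auto
      next
        case False
        then have "Poly_Mapping.lookup z e = 0" if "z \<in> K I" for z I
          using that by (auto simp: K_def intro: base_polytope_lookup_outside[OF E(1) cellE])
        then show ?thesis
          using that(1,2) by simp
      qed
    qed
    show "compact (K I)" for I
    proof -
      have "finite (cell \<B> \<B>s I)"
        using cellE E(1) by (metis finite_Pow_iff finite_subset)
      then show ?thesis
        unfolding K_def base_polytope_eq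
        by (intro compact_Int_closed finite_imp_compact_convex_hull \<open>closed H\<close>) simp
    qed
    show "convex (K I)" for I
      unfolding K_def base_polytope_eq by (intro convex_Int convex_convex_hull \<open>convex H\<close>)
    show "(\<Sum>I | I \<in> Pow {1..t} \<and> x \<in> K I. (-1) ^ card I) = (0::int)" for x
    proof (cases "x \<in> base_polytope \<B> \<inter> H")
      case True
      have KI: "x \<in> K I \<longleftrightarrow> (\<forall>i\<in>I. x \<in> base_polytope (\<B>s i))" if "I \<in> Pow {1..t}" for I
        using True that base_polytope_cell[OF M D, of I] by (auto simp: K_def)
      \<comment> \<open>The sets \<open>I\<close> with \<open>x\<close> in \<open>K I\<close> are
        the subsets of \<open>S\<close>, and \<open>S\<close> is nonempty because the cell polytopes
        cover.\<close>
      define S where "S = {i \<in> {1..t}. x \<in> base_polytope (\<B>s i)}"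
      have "{I \<in> Pow {1..t}. x \<in> K I} = Pow S"
        using KI unfolding S_def by blast
      moreover have "S \<noteq> {}"
        using True D by (auto simp: S_def base_polytope_decomposition_def)
      ultimately show ?thesis
        using sum_neg_one_power_card_Pow[of S] by (simp add: S_def)
    next
      case False
      then have "{I \<in> Pow {1..t}. x \<in> K I} = {}"
        using base_polytope_cell[OF M D] unfolding K_def by blast
      then show ?thesis
        by (simp only: sum.empty)
    qed
  qed
  define S where "S = {i \<in> {1..t}. B \<in> \<B>s i}"
  have "S \<noteq> {}"
    using decomposition_covers[OF M D B] by (auto simp: S_def)
  then have S0: "(\<Sum>I\<in>Pow S. (-1) ^ card I) = (0::int)"
    by (intro sum_neg_one_power_card_Pow) (auto simp: S_def)
  have PowS: "I \<in> Pow S \<longleftrightarrow> I \<in> Pow {1..t} \<and> B \<in> cell \<B> \<B>s I" for I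
    using B by (auto simp: S_def cell_def)
  have Kiff: "K I \<noteq> {} \<longleftrightarrow> B \<in> cell \<B> \<B>s I \<and> \<not> unique_minimizer f (cell \<B> \<B>s I) B" for I
    unfolding K_def H_def by (rule vertex_slice_nonempty_iff[OF E(1) cellE E(3) g])
  have "Pow S = {I \<in> Pow {1..t}. unique_minimizer f (cell \<B> \<B>s I) B} \<union> {I \<in> Pow {1..t}. K I \<noteq> {}}"
    using PowS Kiff unfolding unique_minimizer_def by blast
  moreover have "{I \<in> Pow {1..t}. unique_minimizer f (cell \<B> \<B>s I) B} \<inter> {I \<in> Pow {1..t}. K I \<noteq> {}} = {}"
    using Kiff by blast
  ultimately have "(\<Sum>I\<in>Pow S. (-1) ^ card I) =
      (\<Sum>I | I \<in> Pow {1..t} \<and> unique_minimizer f (cell \<B> \<B>s I) B. (-1) ^ card I)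
      + (\<Sum>I | I \<in> Pow {1..t} \<and> K I \<noteq> {}. (-1) ^ card I :: int)"
    using finP by (simp add: sum.union_disjoint)
  then show ?thesis
    using S0 K0 by simp
qed

section \<open>From minimisers to generic functions and power series\<close>

lemma unique_minimizer_of_nat:
  "unique_minimizer (\<lambda>e. real (f e)) \<C> B \<longleftrightarrow> unique_minimizer f \<C> B"
  by (simp add: unique_minimizer_def flip: of_nat_sum)

lemma unique_minimizer_unique:
  "unique_minimizer f \<C> B \<Longrightarrow> unique_minimizer f \<C> C \<Longrightarrow> B = C"
  by (metis DiffI less_asym singletonD unique_minimizer_def)

lemma generic_iff_unique_minimizer:
  "generic E \<C> f \<longleftrightarrow> f \<in> E \<rightarrow>\<^sub>E {1..} \<and> (\<exists>B. unique_minimizer f \<C> B)"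
proof -
  have "(\<exists>!B. is_arg_min (sum f) (\<lambda>B. B \<in> \<C>) B) \<longleftrightarrow> (\<exists>B. unique_minimizer f \<C> B)"
  proof
    assume "\<exists>!B. is_arg_min (sum f) (\<lambda>B. B \<in> \<C>) B"
    then obtain B where B: "is_arg_min (sum f) (\<lambda>B. B \<in> \<C>) B"
      and uniq: "\<And>C. is_arg_min (sum f) (\<lambda>B. B \<in> \<C>) C \<Longrightarrow> C = B"
      by blast
    have "sum f B < sum f C" if "C \<in> \<C>" "C \<noteq> B" for C
      using that B uniq[of C] by (fastforce simp: is_arg_min_linorder)
    then show "\<exists>B. unique_minimizer f \<C> B"
      using B by (auto simp: unique_minimizer_def is_arg_min_def)
  next
    assume "\<exists>B. unique_minimizer f \<C> B"
    then obtain B where B: "B \<in> \<C>" "\<And>C. C \<in> \<C> \<Longrightarrow> C \<noteq> B \<Longrightarrow> sum f B < sum f C"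
      by (auto simp: unique_minimizer_def)
    show "\<exists>!B. is_arg_min (sum f) (\<lambda>B. B \<in> \<C>) B"
    proof
      show "is_arg_min (sum f) (\<lambda>B. B \<in> \<C>) B"
        using B by (force simp: is_arg_min_def)
      show "C = B" if "is_arg_min (sum f) (\<lambda>B. B \<in> \<C>) C" for C
        using that B by (force simp: is_arg_min_def)
    qed
  qed
  then show ?thesis
    by (simp add: generic_def)
qed

text \<open>Sort the \<open>I\<close> for which \<open>f\<close> is generic by the minimising base;
  uniqueness makes the classes disjoint, and each cancels by itself.\<close>

lemma sum_generic_eq_0:
  assumes M: "matroid E \<B>" and D: "base_polytope_decomposition E \<B> t \<B>s"
  shows "(\<Sum>I | I \<in> Pow {1..t} \<and> generic E (cell \<B> \<B>s I) f. (-1) ^ card I) = (0::int)"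
proof (cases "f \<in> E \<rightarrow>\<^sub>E {1..}")
  case True
  let ?U = "\<lambda>B. {I \<in> Pow {1..t}. unique_minimizer f (cell \<B> \<B>s I) B}"
  have fin: "finite \<B>"
    using M matroid_subset_Pow matroid_finite_ground by (metis finite_Pow_iff finite_subset)
  have "{I \<in> Pow {1..t}. generic E (cell \<B> \<B>s I) f} = (\<Union>B\<in>\<B>. ?U B)"
    using True by (auto simp: generic_iff_unique_minimizer) (auto simp: unique_minimizer_def cell_def)
  moreover have "(\<Sum>I\<in>(\<Union>B\<in>\<B>. ?U B). (-1) ^ card I) = (\<Sum>B\<in>\<B>. \<Sum>I\<in>?U B. (-1) ^ card I :: int)"
  proof (rule sum.UNION_disjoint[OF fin])
    show "\<forall>B\<in>\<B>. \<forall>C\<in>\<B>. B \<noteq> C \<longrightarrow> ?U B \<inter> ?U C = {}"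
      using unique_minimizer_unique by blast
  qed simp
  ultimately have "(\<Sum>I | I \<in> Pow {1..t} \<and> generic E (cell \<B> \<B>s I) f. (-1) ^ card I)
      = (\<Sum>B\<in>\<B>. \<Sum>I\<in>?U B. (-1) ^ card I :: int)"
    by (simp only:)
  also have "\<dots> = 0"
    using sum_unique_minimizer_eq_0[OF M D, of _ "\<lambda>e. real (f e)"]
    by (simp add: unique_minimizer_of_nat)
  finally show ?thesis .
next
  case False
  then show ?thesis
    by (simp add: generic_def)
qed

text \<open>Allows empty intersections to be included in or dropped from the sums freely.\<close>

lemma F_empty: "F E {} m = 0"
  by (simp add: F_def generic_iff_unique_minimizer unique_minimizer_def)

lemma sum_F_cell_eq_0:
  assumes M: "matroid E \<B>" and D: "base_polytope_decomposition E \<B> t \<B>s"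
  shows "(\<Sum>I\<in>Pow {1..t}. (-1) ^ card I * F E (cell \<B> \<B>s I) m) = 0"
proof -
  \<comment> \<open>A single finite set of functions for all \<open>I\<close>, so that the two
    summations can be exchanged.\<close>
  define G where "G = (\<Union>I\<in>Pow {1..t}. {f. generic E (cell \<B> \<B>s I) f \<and> image_mset f (mset_set E) = m})"
  have fin: "finite G"
    unfolding G_def using finite_generic_monomial[OF matroid_finite_ground[OF M]] by simp
  have "F E (cell \<B> \<B>s I) m = (\<Sum>f\<in>G. of_bool (generic E (cell \<B> \<B>s I) f))"
    if "I \<in> Pow {1..t}" for I
  proof -
    have "{f. generic E (cell \<B> \<B>s I) f \<and> image_mset f (mset_set E) = m}
        = G \<inter> {f. generic E (cell \<B> \<B>s I) f}"
      using that by (auto simp: G_def)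
    then show ?thesis
      using fin by (simp add: F_def sum_of_bool_eq)
  qed
  then have "(\<Sum>I\<in>Pow {1..t}. (-1) ^ card I * F E (cell \<B> \<B>s I) m)
      = (\<Sum>I\<in>Pow {1..t}. \<Sum>f\<in>G. (-1) ^ card I * of_bool (generic E (cell \<B> \<B>s I) f))"
    by (intro sum.cong) (simp_all add: sum_distrib_left)
  also have "\<dots> = (\<Sum>f\<in>G. \<Sum>I\<in>Pow {1..t}. (-1) ^ card I * of_bool (generic E (cell \<B> \<B>s I) f))"
    by (rule sum.swap)
  also have "\<dots> = (\<Sum>f\<in>G. \<Sum>I | I \<in> Pow {1..t} \<and> generic E (cell \<B> \<B>s I) f. (-1) ^ card I)"
    by (intro sum.cong refl sum.mono_neutral_cong_right) auto
  also have "\<dots> = 0"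
    using sum_generic_eq_0[OF M D] by simp
  finally show ?thesis .
qed

theorem theorem7p4:
  fixes E :: "'a set" and \<B> :: "'a set set" and t :: nat and \<B>s :: "nat \<Rightarrow> 'a set set"
  assumes "matroid E \<B>"
    and "base_polytope_decomposition E \<B> t \<B>s"
  shows "F E \<B> = (\<lambda>m. \<Sum>j=1..t. (-1) ^ (j - 1) *
           (\<Sum>I | I \<subseteq> {1..t} \<and> card I = j \<and> (\<Inter>i\<in>I. \<B>s i) \<noteq> {}. F E (\<Inter>i\<in>I. \<B>s i) m))"
proof
  fix m
  let ?c = "\<lambda>I. (-1) ^ card I * F E (cell \<B> \<B>s I) m"
  define P where "P = Pow {1..t} - {{}}"
  have cell: "cell \<B> \<B>s I = (\<Inter>i\<in>I. \<B>s i)" if "I \<subseteq> {1..t}" "I \<noteq> {}" for I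
    using decomposition_subset[OF assms] that unfolding cell_def by blast
  have cardP: "card I \<in> {1..t}" if "I \<in> P" for I
  proof -
    have "card I \<noteq> 0"
      using that finite_subset[of I "{1..t}"] by (auto simp: P_def)
    moreover have "card I \<le> t"
      using that card_mono[of "{1..t}" I] by (simp add: P_def)
    ultimately show ?thesis
      by simp
  qed
  \<comment> \<open>The term of the empty set is \<open>F E \<B> m\<close>, because the empty cell
    intersection is \<open>\<B>\<close>.\<close>
  have "(\<Sum>I\<in>Pow {1..t}. ?c I) = ?c {} + sum ?c P"
    unfolding P_def by (intro sum.remove) auto
  then have "F E \<B> m = - sum ?c P"
    using sum_F_cell_eq_0[OF assms, of m] by (simp add: cell_def)
  also have "sum ?c P = (\<Sum>j=1..t. \<Sum>I | I \<in> P \<and> card I = j. ?c I)"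
  proof (rule sum.group[symmetric])
    show "finite P"
      by (simp add: P_def)
    show "card ` P \<subseteq> {1..t}"
      using cardP by (rule image_subsetI)
  qed simp
  also have "- \<dots> = (\<Sum>j=1..t. - (\<Sum>I | I \<in> P \<and> card I = j. ?c I))"
    by (simp add: sum_negf)
  also have "\<dots> = (\<Sum>j=1..t. (-1) ^ (j - 1) *
      (\<Sum>I | I \<subseteq> {1..t} \<and> card I = j \<and> (\<Inter>i\<in>I. \<B>s i) \<noteq> {}. F E (\<Inter>i\<in>I. \<B>s i) m))"
  proof (rule sum.cong[OF refl])
    fix j assume j: "j \<in> {1..t}"
    then have sign: "- ((-1) ^ j) = ((-1) ^ (j - 1) :: int)"
      by (cases j) auto
    have "- (\<Sum>I | I \<in> P \<and> card I = j. ?c I)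
        = (\<Sum>I | I \<in> P \<and> card I = j. (-1) ^ (j - 1) * F E (\<Inter>i\<in>I. \<B>s i) m)"
      unfolding sum_negf[symmetric] sign[symmetric]
      by (intro sum.cong) (auto simp: P_def cell)
    also have "\<dots> = (-1) ^ (j - 1) * (\<Sum>I | I \<in> P \<and> card I = j. F E (\<Inter>i\<in>I. \<B>s i) m)"
      by (simp add: sum_distrib_left)
    \<comment> \<open>Empty intersections contribute 0, and \<open>j \<ge> 1\<close> already
      excludes \<open>I = {}\<close>, whose bare intersection would be the universe.\<close>
    also have "(\<Sum>I | I \<in> P \<and> card I = j. F E (\<Inter>i\<in>I. \<B>s i) m)
        = (\<Sum>I | I \<subseteq> {1..t} \<and> card I = j \<and> (\<Inter>i\<in>I. \<B>s i) \<noteq> {}. F E (\<Inter>i\<in>I. \<B>s i) m)"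
      using j by (intro sum.mono_neutral_right) (auto simp: P_def F_empty)
    finally show "- (\<Sum>I | I \<in> P \<and> card I = j. ?c I) = (-1) ^ (j - 1) *
        (\<Sum>I | I \<subseteq> {1..t} \<and> card I = j \<and> (\<Inter>i\<in>I. \<B>s i) \<noteq> {}. F E (\<Inter>i\<in>I. \<B>s i) m)" .
  qed
  finally show "F E \<B> m = (\<Sum>j=1..t. (-1) ^ (j - 1) *
      (\<Sum>I | I \<subseteq> {1..t} \<and> card I = j \<and> (\<Inter>i\<in>I. \<B>s i) \<noteq> {}. F E (\<Inter>i\<in>I. \<B>s i) m))" .
qed

end
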